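(* Let $q\ge1$, $\mathcal{Y}_1=\mathcal{Y}_2=\mathbb{R}$, $\mathcal{X}=\mathbb{R}^q$, and let $\mu_{\ell3}=\mathrm{Law}(Y_\ell,X)\in\mathcal{P}(\mathbb{R}\times\mathbb{R}^q)$, $\ell=1,2$, have the same projection on $\mathbb{R}^q$. Assume $\mathbb{E}\|X\|_2^2<\infty$, $\mathbb{E}|Y_1|^2<\infty$ and $\mathbb{E}|Y_2|^2<\infty$. For $\ell=1,2$ let $V_\ell=\begin{pmatrix} V_{\ell,YY} & V_{\ell,YX} \\ V_{\ell,XY} & V_{\ell,XX} \end{pmatrix}$ be a positive definite $(1+q)\times(1+q)$ matrix. Let $f(y_1,y_2)=y_2-y_1$. Let $\mathcal{I}$ be the primal of the overlapping W-DMR problem under the costs $c_\ell(s_\ell,s_\ell')=(s_\ell-s_\ell')^\top V_\ell^{-1}(s_\ell-s_\ell')$, $s_\ell=(y_\ell,x_\ell)$, and let $\mathcal{I}_{\mathrm{D}}$ be the primal of the non-overlapping W-DMR problem under the costs $c_{Y_\ell}(y_\ell,y_\ell')=\min_{x_\ell,x_\ell'\in\mathbb{R}^q}c_\ell(s_\ell,s_\ell')=(y_\ell-y_\ell')^\top V_{\ell,YY}^{-1}(y_\ell-y_\ell')$. Then $\mathcal{I}(\delta)\le\mathcal{I}_{\mathrm{D}}(\delta)$ for all $\delta\in\mathbb{R}_{++}^2$.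
   Context: $\mathcal{P}(\cdot)$ denotes Borel probability measures, $\Pi(\mu,\nu)$ couplings; $\mathbb{R}_{++}^2$ is the set of vectors with strictly positive coordinates. $\mathcal{I}(\delta)=\sup_{\gamma\in\Sigma(\delta)}\int f(y_1,y_2)\,d\gamma(y_1,y_2,x)$ with $\Sigma(\delta)=\{\gamma\in\mathcal{P}(\mathbb{R}\times\mathbb{R}\times\mathbb{R}^q):\boldsymbol{K}_\ell(\mu_{\ell3},\gamma_{\ell3})\le\delta_\ell,\ \ell=1,2\}$, where $\gamma_{\ell3}$ is the law of $(y_\ell,x)$ under $\gamma$ and $\boldsymbol{K}_\ell(\mu,\nu)=\inf_{\pi\in\Pi(\mu,\nu)}\int c_\ell\,d\pi$. $\mathcal{I}_{\mathrm{D}}(\delta)=\sup_{\gamma\in\Sigma_{\mathrm{D}}(\delta)}\int f\,d\gamma$ with $\Sigma_{\mathrm{D}}(\delta)=\{\gamma\in\mathcal{P}(\mathbb{R}\times\mathbb{R}):\boldsymbol{K}_{Y_\ell}(\mu_{Y_\ell},\gamma_\ell)\le\delta_\ell,\ \ell=1,2\}$, where $\mu_{Y_\ell}=\mathrm{Law}(Y_\ell)$, $\gamma_\ell$ is the $\ell$-th marginal of $\gamma$ and $\boldsymbol{K}_{Y_\ell}(\mu,\nu)=\inf_{\pi\in\Pi(\mu,\nu)}\int c_{Y_\ell}\,d\pi$. *)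

theory Defs
  imports "HOL-Probability.Probability"
begin

definition borel_probs :: "'a::topological_space measure set" where
  "borel_probs = {\<mu>. prob_space \<mu> \<and> sets \<mu> = sets borel}"

definition couplings ::
    "'a::topological_space measure \<Rightarrow> 'b::topological_space measure \<Rightarrow> ('a \<times> 'b) measure set" where
  "couplings \<mu> \<nu> = {\<pi> \<in> borel_probs. distr \<pi> borel fst = \<mu> \<and> distr \<pi> borel snd = \<nu>}"

(* Values in [0, \<infinity>]; meant for costs c \<ge> 0, since ennreal truncates negative values. *)
definition transport_cost ::
    "('a::topological_space \<Rightarrow> 'a \<Rightarrow> real) \<Rightarrow> 'a measure \<Rightarrow> 'a measure \<Rightarrow> ennreal" where
  "transport_cost c \<mu> \<nu> = (INF \<pi>\<in>couplings \<mu> \<nu>. \<integral>\<^sup>+ p. ennreal (c (fst p) (snd p)) \<partial>\<pi>)"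

definition overlap_set ::
    "('a::topological_space \<times> 'x::topological_space \<Rightarrow> 'a \<times> 'x \<Rightarrow> real) \<Rightarrow>
     ('b::topological_space \<times> 'x \<Rightarrow> 'b \<times> 'x \<Rightarrow> real) \<Rightarrow>
     ('a \<times> 'x) measure \<Rightarrow> ('b \<times> 'x) measure \<Rightarrow> real ^ 2 \<Rightarrow> ('a \<times> 'b \<times> 'x) measure set" where
  "overlap_set c1 c2 \<mu>13 \<mu>23 \<delta> = {\<gamma> \<in> borel_probs.
     transport_cost c1 \<mu>13 (distr \<gamma> borel (\<lambda>(y1, y2, x). (y1, x))) \<le> ennreal (\<delta> $ 1) \<and>
     transport_cost c2 \<mu>23 (distr \<gamma> borel (\<lambda>(y1, y2, x). (y2, x))) \<le> ennreal (\<delta> $ 2)}"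

(* The primal values use the Bochner integral, which is 0 for a non-integrable integrand.  For
   f y1 y2 = y2 - y1, quadratic costs and reference measures with finite second moments this
   convention plays no role: a finite transport cost forces finite second moments of y1 and y2. *)
definition overlap_primal ::
    "('a::topological_space \<Rightarrow> 'b::topological_space \<Rightarrow> real) \<Rightarrow>
     ('a \<times> 'x::topological_space \<Rightarrow> 'a \<times> 'x \<Rightarrow> real) \<Rightarrow>
     ('b \<times> 'x \<Rightarrow> 'b \<times> 'x \<Rightarrow> real) \<Rightarrow>
     ('a \<times> 'x) measure \<Rightarrow> ('b \<times> 'x) measure \<Rightarrow> real ^ 2 \<Rightarrow> ereal" where
  "overlap_primal f c1 c2 \<mu>13 \<mu>23 \<delta> =
     (SUP \<gamma>\<in>overlap_set c1 c2 \<mu>13 \<mu>23 \<delta>. ereal (\<integral>(y1, y2, x). f y1 y2 \<partial>\<gamma>))"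

definition nonoverlap_set ::
    "('a::topological_space \<Rightarrow> 'a \<Rightarrow> real) \<Rightarrow> ('b::topological_space \<Rightarrow> 'b \<Rightarrow> real) \<Rightarrow>
     'a measure \<Rightarrow> 'b measure \<Rightarrow> real ^ 2 \<Rightarrow> ('a \<times> 'b) measure set" where
  "nonoverlap_set c1 c2 \<mu>1 \<mu>2 \<delta> = {\<gamma> \<in> borel_probs.
     transport_cost c1 \<mu>1 (distr \<gamma> borel fst) \<le> ennreal (\<delta> $ 1) \<and>
     transport_cost c2 \<mu>2 (distr \<gamma> borel snd) \<le> ennreal (\<delta> $ 2)}"

definition nonoverlap_primal ::
    "('a::topological_space \<Rightarrow> 'b::topological_space \<Rightarrow> real) \<Rightarrow>
     ('a \<Rightarrow> 'a \<Rightarrow> real) \<Rightarrow> ('b \<Rightarrow> 'b \<Rightarrow> real) \<Rightarrow>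
     'a measure \<Rightarrow> 'b measure \<Rightarrow> real ^ 2 \<Rightarrow> ereal" where
  "nonoverlap_primal f c1 c2 \<mu>1 \<mu>2 \<delta> =
     (SUP \<gamma>\<in>nonoverlap_set c1 c2 \<mu>1 \<mu>2 \<delta>. ereal (\<integral>(y1, y2). f y1 y2 \<partial>\<gamma>))"

definition pos_def_matrix :: "real ^ 'n ^ 'n \<Rightarrow> bool" where
  "pos_def_matrix V \<longleftrightarrow> transpose V = V \<and> (\<forall>v. v \<noteq> 0 \<longrightarrow> v \<bullet> (V *v v) > 0)"

(* (1+q) x (1+q) matrices are indexed by unit + 'q: Inl () is the Y-coordinate, Inr j is the
   j-th X-coordinate, so that V_YY = V $ Inl () $ Inl (). *)
definition stack :: "real \<times> (real ^ 'q) \<Rightarrow> real ^ (unit + 'q)" where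
  "stack s = (\<chi> i. case i of Inl _ \<Rightarrow> fst s | Inr j \<Rightarrow> snd s $ j)"

definition quad_cost ::
    "real ^ (unit + 'q) ^ (unit + 'q::finite) \<Rightarrow> real \<times> (real ^ 'q) \<Rightarrow> real \<times> (real ^ 'q) \<Rightarrow> real" where
  "quad_cost V s s' = (stack s - stack s') \<bullet> (matrix_inv V *v (stack s - stack s'))"

definition quad_cost_Y ::
    "real ^ (unit + 'q) ^ (unit + 'q::finite) \<Rightarrow> real \<Rightarrow> real \<Rightarrow> real" where
  "quad_cost_Y V y y' = (INF (x, x') \<in> UNIV. quad_cost V (y, x) (y', x'))"

end

theory Submission
  imports Defs
begin

text \<open>
  Completing the square shows that the minimum of the quadratic cost over the covariates is the
  quadratic cost with matrix \<open>V\<^bsub>YY\<^esub>\<close>. Since this lower bound depends on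
  \<open>y, y'\<close> only, projecting a coupling of the laws of \<open>(Y, X)\<close> to the
  \<open>Y\<close>-coordinates does not increase its cost. Hence the \<open>(y\<^sub>1, y\<^sub>2)\<close>-marginal of
  a feasible measure of the overlapping problem is feasible for the non-overlapping one, with the
  same objective value.
\<close>

lemma sets_borel_probs: "\<mu> \<in> borel_probs \<Longrightarrow> sets \<mu> = sets borel"
  by (simp add: borel_probs_def)

text \<open>Over arbitrary topological spaces, \<open>borel\<close> on a product type can be larger
  than the product of the Borel sigma-algebras, so measurability of a map built by pairing is
  derived from its continuity.\<close>

lemma continuous_measurable_borel_probs:
  assumes "\<mu> \<in> borel_probs" "continuous_on UNIV g"
  shows "g \<in> \<mu> \<rightarrow>\<^sub>M borel"
  using borel_measurable_continuous_onI[OF assms(2)]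
  by (simp add: measurable_cong_sets[OF sets_borel_probs[OF assms(1)] refl])

lemma distr_borel_probs:
  assumes "\<mu> \<in> borel_probs" "continuous_on UNIV g"
  shows "distr \<mu> borel g \<in> borel_probs"
  using assms continuous_measurable_borel_probs[OF assms]
  by (auto simp: borel_probs_def intro: prob_space.prob_space_distr)

lemma distr_distr_borel_probs:
  assumes "\<mu> \<in> borel_probs" "continuous_on UNIV g" "continuous_on UNIV h"
  shows "distr (distr \<mu> borel g) borel h = distr \<mu> borel (\<lambda>x. h (g x))"
  using distr_distr[OF borel_measurable_continuous_onI[OF assms(3)]
      continuous_measurable_borel_probs[OF assms(1,2)]]
  by (simp add: comp_def)

text \<open>Projecting after a product map is mapping after a projection, so the marginals of the
  pushed-forward coupling are the pushed-forward marginals.\<close>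

lemma map_prod_couplings:
  assumes \<pi>: "\<pi> \<in> couplings \<mu> \<nu>"
    and g: "continuous_on UNIV g" and h: "continuous_on UNIV h"
  shows "distr \<pi> borel (\<lambda>p. (g (fst p), h (snd p))) \<in> couplings (distr \<mu> borel g) (distr \<nu> borel h)"
proof -
  have b: "\<pi> \<in> borel_probs" and m: "distr \<pi> borel fst = \<mu>" "distr \<pi> borel snd = \<nu>"
    using \<pi> by (auto simp: couplings_def)
  have gf: "continuous_on UNIV (\<lambda>p. g (fst p))" and hs: "continuous_on UNIV (\<lambda>p. h (snd p))"
    by (auto intro!: continuous_intros continuous_on_compose2[OF g] continuous_on_compose2[OF h])
  have gh: "continuous_on UNIV (\<lambda>p. (g (fst p), h (snd p)))"
    by (intro continuous_on_Pair gf hs)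
  show ?thesis
    using distr_borel_probs[OF b gh]
    by (simp add: couplings_def m[symmetric] distr_distr_borel_probs[OF b gh] continuous_on_fst
        continuous_on_snd distr_distr_borel_probs[OF b _ g] distr_distr_borel_probs[OF b _ h])
qed

text \<open>Applying \<open>g\<close> to both points of a coupling on the right yields a competitor
  for the infimum on the left that costs no more. Measurability of \<open>c'\<close> serves the
  change of variables.\<close>

lemma transport_cost_distr_le:
  assumes g: "continuous_on UNIV g"
    and meas: "(\<lambda>p. c' (fst p) (snd p)) \<in> borel_measurable borel"
    and le: "\<And>s t. c' (g s) (g t) \<le> c s t"
  shows "transport_cost c' (distr \<mu> borel g) (distr \<nu> borel g) \<le> transport_cost c \<mu> \<nu>"
  unfolding transport_cost_def
proof (rule INF_mono)
  fix \<pi> assume \<pi>: "\<pi> \<in> couplings \<mu> \<nu>"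
  let ?G = "\<lambda>p. (g (fst p), g (snd p))"
  have b: "\<pi> \<in> borel_probs"
    using \<pi> by (simp add: couplings_def)
  have G: "continuous_on UNIV ?G"
    by (auto intro!: continuous_intros continuous_on_compose2[OF g])
  have "(\<integral>\<^sup>+ p. ennreal (c' (fst p) (snd p)) \<partial>distr \<pi> borel ?G)
      = (\<integral>\<^sup>+ p. ennreal (c' (g (fst p)) (g (snd p))) \<partial>\<pi>)"
    using meas by (subst nn_integral_distr[OF continuous_measurable_borel_probs[OF b G]]) auto
  also have "\<dots> \<le> (\<integral>\<^sup>+ p. ennreal (c (fst p) (snd p)) \<partial>\<pi>)"
    by (intro nn_integral_mono ennreal_leI le)
  finally show "\<exists>\<pi>'\<in>couplings (distr \<mu> borel g) (distr \<nu> borel g).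
      (\<integral>\<^sup>+ p. ennreal (c' (fst p) (snd p)) \<partial>\<pi>') \<le> (\<integral>\<^sup>+ p. ennreal (c (fst p) (snd p)) \<partial>\<pi>)"
    using map_prod_couplings[OF \<pi> g g] by blast
qed

text \<open>\<open>matrix_inv\<close> is defined by choice, so existence of an inverse comes first:
  a vector in the kernel of \<open>V\<close> makes the quadratic form vanish and is therefore
  zero.\<close>

lemma pos_def_matrix_inverse:
  assumes "pos_def_matrix V"
  shows "V *v (matrix_inv V *v v) = v" "matrix_inv V *v (V *v v) = v"
proof -
  have "inj ((*v) V)"
  proof (rule injI)
    fix x y assume "V *v x = V *v y"
    then have "(x - y) \<bullet> (V *v (x - y)) = 0"
      by (simp add: matrix_vector_mult_diff_distrib)
    with assms show "x = y"
      unfolding pos_def_matrix_def by (metis eq_iff_diff_eq_0 less_irrefl)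
  qed
  then have "invertible V"
    by (simp add: invertible_left_inverse matrix_left_invertible_injective)
  then have "V ** matrix_inv V = mat 1 \<and> matrix_inv V ** V = mat 1"
    unfolding invertible_def matrix_inv_def by (rule someI_ex)
  then show "V *v (matrix_inv V *v v) = v" "matrix_inv V *v (V *v v) = v"
    by (simp_all add: matrix_vector_mul_assoc)
qed

lemma pos_def_matrix_diag_pos:
  assumes "pos_def_matrix V"
  shows "V $ i $ i > 0"
proof -
  have "axis i 1 \<bullet> (V *v axis i 1) > 0"
    using assms by (simp add: pos_def_matrix_def)
  then show ?thesis
    by (simp add: matrix_vector_mult_basis inner_axis' column_def)
qed

text \<open>This is Cauchy-Schwarz for the inner product defined by \<open>V\<close>:
  \<open>v $ i\<close> is the product of \<open>matrix_inv V *v v\<close> with the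
  \<open>i\<close>-th basis vector, whose squared length is \<open>V $ i $ i\<close>.\<close>

lemma pos_def_matrix_inv_quadratic_ge:
  fixes V :: "real ^ 'n ^ 'n"
  assumes V: "pos_def_matrix V"
  shows "(v $ i)\<^sup>2 / V $ i $ i \<le> v \<bullet> (matrix_inv V *v v)"
proof -
  define w where "w = matrix_inv V *v v"
  \<comment> \<open>This \<open>t\<close> minimises the quadratic form at
    \<open>w - t *\<^sub>R e\<close>, so nonnegativity there gives the sharpest bound.\<close>
  define t where "t = v $ i / V $ i $ i"
  define e :: "real ^ 'n" where "e = axis i 1"
  have v: "V *v w = v"
    using pos_def_matrix_inverse[OF V] by (simp add: w_def)
  have d: "V $ i $ i > 0"
    by (rule pos_def_matrix_diag_pos[OF V])
  have eVe: "e \<bullet> (V *v e) = V $ i $ i"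
    by (simp add: e_def matrix_vector_mult_basis inner_axis' column_def)
  have ev: "e \<bullet> v = v $ i"
    by (simp add: e_def inner_axis')
  \<comment> \<open>Symmetry moves \<open>V\<close> onto \<open>w\<close>, where
    \<open>V *v w = v\<close>.\<close>
  have wVe: "w \<bullet> (V *v e) = v $ i"
    using V ev v by (metis dot_lmul_matrix inner_commute pos_def_matrix_def transpose_matrix_vector)
  have "0 \<le> (w - t *\<^sub>R e) \<bullet> (V *v (w - t *\<^sub>R e))"
    using V unfolding pos_def_matrix_def by (cases "w - t *\<^sub>R e = 0") (auto intro: less_imp_le)
  also have "\<dots> = w \<bullet> v - 2 * t * v $ i + t\<^sup>2 * V $ i $ i"
    by (simp add: matrix_vector_mult_diff_distrib matrix_vector_mult_scaleR v inner_diff_left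
        inner_diff_right eVe ev wVe power2_eq_square algebra_simps)
  also have "\<dots> = w \<bullet> v - (v $ i)\<^sup>2 / V $ i $ i"
    using d by (simp add: t_def power2_eq_square field_simps)
  finally show ?thesis
    by (simp add: w_def inner_commute)
qed

lemma quad_cost_ge:
  assumes "pos_def_matrix V"
  shows "(y - y') * inverse (V $ Inl () $ Inl ()) * (y - y') \<le> quad_cost V (y, x) (y', x')"
  using pos_def_matrix_inv_quadratic_ge[OF assms, of "stack (y, x) - stack (y', x')" "Inl ()"]
  by (simp add: quad_cost_def stack_def power2_eq_square field_simps)

text \<open>The minimum is attained where the increment is a multiple of the \<open>Y\<close>-column of \<open>V\<close>.\<close>

lemma quad_cost_attained:
  fixes V :: "real ^ (unit + 'q::finite) ^ (unit + 'q)"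
  assumes V: "pos_def_matrix V"
  shows "\<exists>x x'. quad_cost V (y, x) (y', x') = (y - y') * inverse (V $ Inl () $ Inl ()) * (y - y')"
proof -
  \<comment> \<open>With this \<open>t\<close> the \<open>Y\<close>-entry of
    \<open>V *v (t *\<^sub>R e)\<close> is \<open>y - y'\<close>; the other entries define
    \<open>x\<close>, and the second covariate is \<open>0\<close>.\<close>
  define t where "t = (y - y') / V $ Inl () $ Inl ()"
  define e :: "real ^ (unit + 'q)" where "e = axis (Inl ()) 1"
  define x :: "real ^ 'q" where "x = (\<chi> j. t * V $ Inr j $ Inl ())"
  have d: "V $ Inl () $ Inl () > 0"
    by (rule pos_def_matrix_diag_pos[OF V])
  have *: "stack (y, x) - stack (y', 0) = V *v (t *\<^sub>R e)"
    using d by (auto simp: vec_eq_iff stack_def x_def e_def matrix_vector_mult_scaleR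
        matrix_vector_mult_basis column_def t_def split: sum.split)
  \<comment> \<open>The inverse cancels against \<open>V\<close>, leaving the product of
    \<open>V *v (t *\<^sub>R e)\<close> with \<open>t *\<^sub>R e\<close>, which sees only the
    \<open>Y\<close>-entry.\<close>
  have "quad_cost V (y, x) (y', 0) = t * t * V $ Inl () $ Inl ()"
    unfolding quad_cost_def * pos_def_matrix_inverse[OF V]
    by (simp add: e_def matrix_vector_mult_scaleR matrix_vector_mult_basis inner_axis column_def)
  then have "quad_cost V (y, x) (y', 0) = (y - y') * inverse (V $ Inl () $ Inl ()) * (y - y')"
    by (simp add: t_def divide_inverse mult_ac) (use d in simp)
  then show ?thesis
    by blast
qed

text \<open>The infimum is taken in the reals, where a lower bound that is attained determines
  it.\<close>

lemma quad_cost_Y_eq: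
  assumes V: "pos_def_matrix V"
  shows "quad_cost_Y V y y' = (y - y') * inverse (V $ Inl () $ Inl ()) * (y - y')"
proof -
  obtain x x' where "quad_cost V (y, x) (y', x') = (y - y') * inverse (V $ Inl () $ Inl ()) * (y - y')"
    using quad_cost_attained[OF V] by blast
  then show ?thesis
    unfolding quad_cost_Y_def
    by (intro cInf_eq_minimum) (auto simp: quad_cost_ge[OF V] intro!: range_eqI[of _ _ "(x, x')"])
qed

lemma transport_cost_quad_cost_Y_le:
  assumes V: "pos_def_matrix V"
  shows "transport_cost (quad_cost_Y V) (distr \<mu> borel fst) (distr \<nu> borel fst)
    \<le> transport_cost (quad_cost V) \<mu> \<nu>"
proof (rule transport_cost_distr_le)
  show "continuous_on UNIV (fst :: real \<times> (real ^ 'a) \<Rightarrow> real)"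
    by (intro continuous_intros)
  show "(\<lambda>p. quad_cost_Y V (fst p) (snd p)) \<in> borel_measurable borel"
    \<comment> \<open>The closed form replaces an infimum over uncountably many pairs by a
      continuous function.\<close>
    unfolding quad_cost_Y_eq[OF V]
    by (intro borel_measurable_continuous_onI continuous_intros)
  show "quad_cost_Y V (fst s) (fst t) \<le> quad_cost V s t" for s t
    using quad_cost_ge[OF V, of "fst s" "fst t" "snd s" "snd t"] by (simp add: quad_cost_Y_eq[OF V])
qed

lemma overlap_set_marginal:
  fixes V1 V2 :: "real ^ (unit + 'q::finite) ^ (unit + 'q)"
  assumes V: "pos_def_matrix V1" "pos_def_matrix V2"
    and \<gamma>: "\<gamma> \<in> overlap_set (quad_cost V1) (quad_cost V2) \<mu>13 \<mu>23 \<delta>"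
  shows "distr \<gamma> borel (\<lambda>(y1, y2, x). (y1, y2))
    \<in> nonoverlap_set (quad_cost_Y V1) (quad_cost_Y V2) (distr \<mu>13 borel fst) (distr \<mu>23 borel fst) \<delta>"
proof -
  have b: "\<gamma> \<in> borel_probs"
    using \<gamma> by (simp add: overlap_set_def)
  have c: "continuous_on UNIV (\<lambda>(y1 :: real, y2 :: real, x :: real ^ 'q). (y1, y2))"
    by (auto simp: case_prod_beta intro!: continuous_intros)
  \<comment> \<open>Dropping \<open>x\<close> and then \<open>y2\<close>, or \<open>y2\<close> and
    then \<open>x\<close>, leaves the same law of \<open>y1\<close>. This links the constraints of
    the two problems.\<close>
  have "distr (distr \<gamma> borel (\<lambda>(y1, y2, x). (y1, y2))) borel fst
      = distr (distr \<gamma> borel (\<lambda>(y1, y2, x). (y1, x))) borel fst"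
    by (subst (1 2) distr_distr_borel_probs[OF b])
      (auto simp: case_prod_beta intro!: continuous_intros)
  moreover have "distr (distr \<gamma> borel (\<lambda>(y1, y2, x). (y1, y2))) borel snd
      = distr (distr \<gamma> borel (\<lambda>(y1, y2, x). (y2, x))) borel fst"
    by (subst (1 2) distr_distr_borel_probs[OF b])
      (auto simp: case_prod_beta intro!: continuous_intros)
  ultimately show ?thesis
    using \<gamma> distr_borel_probs[OF b c] order_trans[OF transport_cost_quad_cost_Y_le[OF V(1)]]
      order_trans[OF transport_cost_quad_cost_Y_le[OF V(2)]]
    by (simp add: overlap_set_def nonoverlap_set_def)
qed

text \<open>The first conjunct certifies that the infimum defining \<open>quad_cost_Y\<close> is a
  genuine minimum.\<close>

theorem proposition6p2:
  fixes \<mu>13 \<mu>23 :: "(real \<times> (real ^ 'q::finite)) measure"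
    and V1 V2 :: "real ^ (unit + 'q) ^ (unit + 'q)"
  assumes "\<mu>13 \<in> borel_probs" and "\<mu>23 \<in> borel_probs"
    and "distr \<mu>13 borel snd = distr \<mu>23 borel snd"
    and "integrable \<mu>13 (\<lambda>(y, x). (norm x)\<^sup>2)"
    and "integrable \<mu>13 (\<lambda>(y, x). \<bar>y\<bar>\<^sup>2)"
    and "integrable \<mu>23 (\<lambda>(y, x). \<bar>y\<bar>\<^sup>2)"
    and "pos_def_matrix V1" and "pos_def_matrix V2"
  shows "(\<forall>V \<in> {V1, V2}. \<forall>y y'.
           (\<exists>x x'. quad_cost V (y, x) (y', x') = quad_cost_Y V y y') \<and>
           (\<forall>x x'. quad_cost_Y V y y' \<le> quad_cost V (y, x) (y', x')) \<and>
           quad_cost_Y V y y' = (y - y') * inverse (V $ Inl () $ Inl ()) * (y - y')) \<and>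
         (\<forall>\<delta> :: real ^ 2. (\<forall>i. 0 < \<delta> $ i) \<longrightarrow>
           overlap_primal (\<lambda>y1 y2. y2 - y1) (quad_cost V1) (quad_cost V2) \<mu>13 \<mu>23 \<delta>
           \<le> nonoverlap_primal (\<lambda>y1 y2. y2 - y1) (quad_cost_Y V1) (quad_cost_Y V2)
               (distr \<mu>13 borel fst) (distr \<mu>23 borel fst) \<delta>)"
proof (intro conjI ballI allI impI)
  fix V y y' assume "V \<in> {V1, V2}"
  then have V: "pos_def_matrix V"
    using assms by auto
  show "\<exists>x x'. quad_cost V (y, x) (y', x') = quad_cost_Y V y y'"
    using quad_cost_attained[OF V] by (simp add: quad_cost_Y_eq[OF V])
  show "quad_cost_Y V y y' \<le> quad_cost V (y, x) (y', x')" for x x'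
    using quad_cost_ge[OF V] by (simp add: quad_cost_Y_eq[OF V])
  show "quad_cost_Y V y y' = (y - y') * inverse (V $ Inl () $ Inl ()) * (y - y')"
    by (rule quad_cost_Y_eq[OF V])
next
  fix \<delta> :: "real ^ 2"
  show "overlap_primal (\<lambda>y1 y2. y2 - y1) (quad_cost V1) (quad_cost V2) \<mu>13 \<mu>23 \<delta>
      \<le> nonoverlap_primal (\<lambda>y1 y2. y2 - y1) (quad_cost_Y V1) (quad_cost_Y V2)
          (distr \<mu>13 borel fst) (distr \<mu>23 borel fst) \<delta>"
    unfolding overlap_primal_def nonoverlap_primal_def
  proof (rule SUP_mono)
    fix \<gamma> assume \<gamma>: "\<gamma> \<in> overlap_set (quad_cost V1) (quad_cost V2) \<mu>13 \<mu>23 \<delta>"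
    let ?g = "\<lambda>(y1 :: real, y2 :: real, x :: real ^ 'q). (y1, y2)"
    have b: "\<gamma> \<in> borel_probs"
      using \<gamma> by (simp add: overlap_set_def)
    have "?g \<in> \<gamma> \<rightarrow>\<^sub>M borel"
      by (rule continuous_measurable_borel_probs[OF b])
        (auto simp: case_prod_beta intro!: continuous_intros)
    moreover have "(\<lambda>(y1, y2). y2 - y1 :: real) \<in> borel_measurable borel"
      by (auto simp: case_prod_beta intro!: borel_measurable_continuous_onI continuous_intros)
    \<comment> \<open>The change of variables asks only for measurability, so the default value
      \<open>0\<close> of a non-integrable integrand would occur on both sides at once.\<close>
    ultimately have "(\<integral>(y1, y2). (y2 - y1 :: real) \<partial>distr \<gamma> borel ?g) = (\<integral>(y1, y2, x). (y2 - y1 :: real) \<partial>\<gamma>)"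
      by (simp add: integral_distr case_prod_beta')
    then show "\<exists>\<gamma>'\<in>nonoverlap_set (quad_cost_Y V1) (quad_cost_Y V2)
        (distr \<mu>13 borel fst) (distr \<mu>23 borel fst) \<delta>.
        ereal (\<integral>(y1, y2, x). y2 - y1 \<partial>\<gamma>) \<le> ereal (\<integral>(y1, y2). y2 - y1 \<partial>\<gamma>')"
      using overlap_set_marginal[OF assms(7,8) \<gamma>] by (intro bexI) auto
  qed
qed

end
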